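(* Let $G$ be a finite group. The following are equivalent: (1) $G$ is nested; (2) there is a chain of normal subgroups $G=X_0>X_1>\dots>X_n\ge 1$ such that for every normal subgroup $N$ of $G$ we have $Z(G/N)=X_i/N$ for some $i\in\{0,\dots,n\}$; (3) for all normal subgroups $N,M$ of $G$, defining $Z_N$ and $Z_M$ by $Z_N/N=Z(G/N)$ and $Z_M/M=Z(G/M)$, either $Z_N\le Z_M$ or $Z_M\le Z_N$. Moreover, if in (2) for every $i\in\{0,\dots,n\}$ there exists a normal subgroup $N$ with $Z(G/N)=X_i/N$, then $G=X_0>X_1>\dots>X_n$ is exactly the chain of centers of $G$.
   Context: All groups are finite; $\mathrm{Irr}(G)$ is the set of complex irreducible characters of $G$. For $\chi\in\mathrm{Irr}(G)$, $Z(\chi)=\{g\in G: |\chi(g)|=\chi(1)\}$ is the center of $\chi$ (a normal subgroup with $Z(\chi)/\ker\chi=Z(G/\ker\chi)$). A group $G$ is nested if for all $\chi,\psi\in\mathrm{Irr}(G)$ either $Z(\chi)\le Z(\psi)$ or $Z(\psi)\le Z(\chi)$. If $G$ is nested, the distinct subgroups in $\{Z(\chi):\chi\in\mathrm{Irr}(G)\}$ form a chain $G=X_0>X_1>\dots>X_n\ge1$, called the chain of centers of $G$. *)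

theory Defs
  imports "HOL-Algebra.Coset" "Jordan_Normal_Form.Matrix"
begin

definition is_rep :: "('a, 'b) monoid_scheme \<Rightarrow> nat \<Rightarrow> ('a \<Rightarrow> complex mat) \<Rightarrow> bool" where
  "is_rep G d \<rho> \<longleftrightarrow> 0 < d \<and>
     (\<forall>g \<in> carrier G. \<rho> g \<in> carrier_mat d d) \<and>
     \<rho> \<one>\<^bsub>G\<^esub> = 1\<^sub>m d \<and>
     (\<forall>g \<in> carrier G. \<forall>h \<in> carrier G. \<rho> (g \<otimes>\<^bsub>G\<^esub> h) = \<rho> g * \<rho> h)"

definition is_subspace :: "nat \<Rightarrow> complex vec set \<Rightarrow> bool" where
  "is_subspace d W \<longleftrightarrow> W \<subseteq> carrier_vec d \<and> 0\<^sub>v d \<in> W \<and>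
     (\<forall>v \<in> W. \<forall>w \<in> W. v + w \<in> W) \<and>
     (\<forall>c. \<forall>v \<in> W. c \<cdot>\<^sub>v v \<in> W)"

definition irreducible_rep :: "('a, 'b) monoid_scheme \<Rightarrow> nat \<Rightarrow> ('a \<Rightarrow> complex mat) \<Rightarrow> bool" where
  "irreducible_rep G d \<rho> \<longleftrightarrow> is_rep G d \<rho> \<and>
     (\<forall>W. is_subspace d W \<and> (\<forall>g \<in> carrier G. \<forall>v \<in> W. \<rho> g *\<^sub>v v \<in> W)
          \<longrightarrow> W = {0\<^sub>v d} \<or> W = carrier_vec d)"

definition mat_trace :: "complex mat \<Rightarrow> complex" where
  "mat_trace A = (\<Sum>i < dim_row A. A $$ (i, i))"

definition character :: "('a, 'b) monoid_scheme \<Rightarrow> ('a \<Rightarrow> complex mat) \<Rightarrow> 'a \<Rightarrow> complex" where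
  "character G \<rho> = (\<lambda>g. if g \<in> carrier G then mat_trace (\<rho> g) else 0)"

definition Irr :: "('a, 'b) monoid_scheme \<Rightarrow> ('a \<Rightarrow> complex) set" where
  "Irr G = {\<chi>. \<exists>d \<rho>. irreducible_rep G d \<rho> \<and> \<chi> = character G \<rho>}"

definition char_center :: "('a, 'b) monoid_scheme \<Rightarrow> ('a \<Rightarrow> complex) \<Rightarrow> 'a set" where
  "char_center G \<chi> = {g \<in> carrier G. complex_of_real (cmod (\<chi> g)) = \<chi> \<one>\<^bsub>G\<^esub>}"

definition nested :: "('a, 'b) monoid_scheme \<Rightarrow> bool" where
  "nested G \<longleftrightarrow> (\<forall>\<chi> \<in> Irr G. \<forall>\<psi> \<in> Irr G.
      char_center G \<chi> \<subseteq> char_center G \<psi> \<or> char_center G \<psi> \<subseteq> char_center G \<chi>)"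

text \<open>The set of centers of irreducible characters (whose elements form the
  chain of centers when G is nested).\<close>
definition centers :: "('a, 'b) monoid_scheme \<Rightarrow> 'a set set" where
  "centers G = char_center G ` Irr G"

definition quot_center :: "('a, 'b) monoid_scheme \<Rightarrow> 'a set \<Rightarrow> 'a set set" where
  "quot_center G N = {C \<in> carrier (G Mod N). \<forall>D \<in> carrier (G Mod N).
      C \<otimes>\<^bsub>G Mod N\<^esub> D = D \<otimes>\<^bsub>G Mod N\<^esub> C}"

text \<open>Z_N: the subgroup of G with Z_N/N = Z(G/N), i.e. the full preimage of
  Z(G/N) under the canonical projection g \<mapsto> N g.\<close>
definition Zq :: "('a, 'b) monoid_scheme \<Rightarrow> 'a set \<Rightarrow> 'a set" where
  "Zq G N = {g \<in> carrier G. N #>\<^bsub>G\<^esub> g \<in> quot_center G N}"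

end

theory Submission
  imports Defs
    "Jordan_Normal_Form.DL_Rank"
    "Jordan_Normal_Form.Spectral_Radius"
    "HOL-Analysis.Linear_Algebra"
    "HOL-Algebra.Multiplicative_Group"
begin

text \<open>
  For an irreducible representation with kernel \<open>K\<close> and character \<open>\<chi>\<close>, an element lies in
  \<open>Z(\<chi>)\<close> iff it acts as a scalar (a matrix of finite order whose trace has maximal modulus is
  scalar), iff it is central modulo \<open>K\<close> (Schur's lemma); hence \<open>Z(\<chi>) = Z\<^sub>K\<close>.
  Conversely, the irreducible representations of \<open>G/N\<close> separate its elements, so \<open>Z\<^sub>N\<close> is the
  intersection of the centers \<open>Z(\<chi>)\<close> with \<open>N \<le> ker \<chi>\<close>. If \<open>G\<close> is nested, these form a finite
  chain, so \<open>Z\<^sub>N\<close> is itself a center, and the sets \<open>Z\<^sub>N\<close> are exactly the centers of the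
  irreducible characters.

  No complete reducibility is needed for the separation: a reducible representation is block
  triangular, and a block triangular matrix of finite order with identity diagonal blocks is the
  identity, so an element acting nontrivially acts nontrivially on one of the two smaller blocks.
\<close>

subsection \<open>Invariant subspaces and block triangular form\<close>


text \<open>Independent sets have at most \<open>n\<close> elements, so some independent set between
  \<open>B\<close> and \<open>S\<close> is maximal; a vector of \<open>S\<close> outside its span
  could still be adjoined. For a subspace \<open>S\<close> this extends \<open>B\<close> to a basis
  of \<open>S\<close>.\<close>

lemma (in vec_space) maximal_lin_indpt_extension:
  fixes S :: "'a vec set"
  assumes S: "S \<subseteq> carrier_vec n" and B: "B \<subseteq> S" "lin_indpt B"
  obtains C where "finite C" "B \<subseteq> C" "C \<subseteq> S" "lin_indpt C" "S \<subseteq> span C"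
proof -
  have bnd: "finite A \<and> card A \<le> n" if "B \<subseteq> A \<and> A \<subseteq> S \<and> lin_indpt A" for A
    using that S li_le_dim[OF fin_dim, of A] dim_is_n by auto
  obtain C where C: "finite C" "maximal C (\<lambda>A. B \<subseteq> A \<and> A \<subseteq> S \<and> lin_indpt A)"
    using maximal_exists[of "\<lambda>A. B \<subseteq> A \<and> A \<subseteq> S \<and> lin_indpt A" n B] bnd B by blast
  then have C': "B \<subseteq> C" "C \<subseteq> S" "lin_indpt C" unfolding maximal_def by auto
  have "S \<subseteq> span C"
  proof
    fix v assume v: "v \<in> S"
    show "v \<in> span C"
    proof (rule ccontr)
      assume nv: "v \<notin> span C"
      have CC: "C \<subseteq> carrier_vec n" using C' S by auto
      have "v \<notin> C" using nv span_mem[of C v] CC by auto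
      then have "lin_indpt (C \<union> {v})"
        using lin_dep_iff_in_span[of C v] nv CC C' v S by auto
      then have "C \<union> {v} = C" using C(2) v C' unfolding maximal_def by auto
      then show False using \<open>v \<notin> C\<close> by auto
    qed
  qed
  then show thesis using that C C' by blast
qed

text \<open>A basis of \<open>W\<close> is extended to one of the whole space and written into the
  columns of \<open>P\<close>, the vectors from \<open>W\<close> first. In these coordinates
  \<open>W\<close> consists of the vectors supported on the first \<open>k\<close> entries.\<close>

lemma (in vec_space) adapted_basis:
  fixes W :: "'a vec set"
  assumes W: "W \<subseteq> carrier_vec n" "0\<^sub>v n \<in> W"
    "\<And>v w. v \<in> W \<Longrightarrow> w \<in> W \<Longrightarrow> v + w \<in> W" "\<And>c v. v \<in> W \<Longrightarrow> c \<cdot>\<^sub>v v \<in> W"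
  obtains k P where "k \<le> n" "P \<in> carrier_mat n n" "det P \<noteq> 0"
    "W = {P *\<^sub>v x | x. x \<in> carrier_vec n \<and> (\<forall>i<n. k \<le> i \<longrightarrow> x $ i = 0)}"
proof -
  have li0: "lin_indpt {}" unfolding lin_dep_def by auto
  obtain B where B: "finite B" "B \<subseteq> W" "lin_indpt B" "W \<subseteq> span B"
    by (rule maximal_lin_indpt_extension[OF W(1) empty_subsetI li0])
  obtain C where C: "finite C" "B \<subseteq> C" "C \<subseteq> carrier_vec n" "lin_indpt C" "carrier_vec n \<subseteq> span C"
    by (rule maximal_lin_indpt_extension[OF subset_refl subset_trans[OF B(2) W(1)] B(3)])
  have "basis C" unfolding basis_def using C by (auto intro: span_is_subset2)
  then have cC: "card C = n" using dim_basis[OF C(1)] dim_is_n by auto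
  obtain bs where bs: "set bs = B" "distinct bs" using finite_distinct_list[OF B(1)] by auto
  obtain cs where cs: "set cs = C - B" "distinct cs" using finite_distinct_list[of "C - B"] C(1) by auto
  define ps where "ps = bs @ cs"
  have ps: "set ps = C" "distinct ps" using bs cs C(2) by (auto simp: ps_def)
  have len: "length ps = n" using ps cC distinct_card by fastforce
  define k where "k = length bs"
  have k: "k \<le> n" using len by (simp add: k_def ps_def)
  have nthB: "ps ! i \<in> B \<longleftrightarrow> i < k" if "i < n" for i
  proof (cases "i < k")
    case True then show ?thesis using bs by (auto simp: ps_def k_def nth_append)
  next
    case False
    then have "ps ! i \<in> set cs" using that len by (auto simp: ps_def k_def nth_append)
    then show ?thesis using False cs by auto
  qed
  define P where "P = mat_of_cols n ps"
  have P: "P \<in> carrier_mat n n" using len by (auto simp: P_def)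
  have cols: "cols P = ps" unfolding P_def using ps C by (intro cols_mat_of_cols) auto
  have colP: "col P i = ps ! i" if "i < n" for i using cols that P by (metis cols_nth carrier_matD(2))
  have "rank P = n" using lin_indpt_full_rank[OF P] cols ps C by auto
  then have det: "det P \<noteq> 0" using det_rank_iff[OF P] by auto
  \<comment> \<open>\<open>lincomb\<close> takes coefficients indexed by vectors, while
    \<open>P\<close> acts on coordinates indexed by positions; this translates between the
    two.\<close>
  have mult: "P *\<^sub>v (vec n (\<lambda>i. a (ps ! i))) = lincomb a C" for a
  proof -
    have "vec n (\<lambda>i. a (ps ! i)) = vec n (\<lambda>i. a (col P i))" using colP by auto
    then show ?thesis using mat_mult_eq_lincomb[OF P, of a] cols ps by simp
  qed
  have BW: "lincomb a A \<in> W" if "A \<subseteq> B" for a A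
  proof -
    have "finite A" using that B(1) finite_subset by auto
    then show ?thesis using that
    proof (induction A)
      case empty
      then show ?case using W(2) by (simp add: lincomb_def)
    next
      case (insert v A)
      then have "v \<in> carrier_vec n" "A \<subseteq> carrier_vec n" using B(2) W(1) by auto
      then show ?case using insert B(2) by (subst lincomb_insert2) (auto intro!: W)
    qed
  qed
  have eq: "lincomb a C = lincomb b B" if "\<And>v. v \<in> B \<Longrightarrow> a v = b v" "\<And>v. v \<in> C - B \<Longrightarrow> a v = 0" for a b
  proof (rule eq_vecI)
    have Bn: "B \<subseteq> carrier_vec n" using B W by auto
    show "dim_vec (lincomb a C) = dim_vec (lincomb b B)" using lincomb_dim[OF C(1,3)] lincomb_dim[OF B(1) Bn] by simp
    fix i assume "i < dim_vec (lincomb b B)"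
    then have i: "i < n" using lincomb_dim[OF B(1) Bn] by simp
    show "lincomb a C $ i = lincomb b B $ i"
      unfolding lincomb_index[OF i C(3)] lincomb_index[OF i Bn]
      using that C(1,2) by (intro sum.mono_neutral_cong_right) auto
  qed
  have "W = {P *\<^sub>v x | x. x \<in> carrier_vec n \<and> (\<forall>i<n. k \<le> i \<longrightarrow> x $ i = 0)}" (is "_ = ?R")
  proof (intro equalityI subsetI)
    fix w assume "w \<in> W"
    then obtain a where w: "w = lincomb a B" using B finite_in_span[of B w] W(1) by blast
    define a' where "a' v = (if v \<in> B then a v else 0)" for v
    have "w = P *\<^sub>v vec n (\<lambda>i. a' (ps ! i))" unfolding mult w by (rule eq[symmetric]) (auto simp: a'_def)
    moreover have "\<forall>i<n. k \<le> i \<longrightarrow> vec n (\<lambda>i. a' (ps ! i)) $ i = 0" using nthB by (auto simp: a'_def)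
    ultimately show "w \<in> ?R" by (intro CollectI exI[of _ "vec n (\<lambda>i. a' (ps ! i))"]) auto
  next
    fix w assume "w \<in> ?R"
    then obtain x where x: "w = P *\<^sub>v x" "x \<in> carrier_vec n" "\<forall>i<n. k \<le> i \<longrightarrow> x $ i = 0" by auto
    \<comment> \<open>Each vector of \<open>C\<close> occurs at exactly one position of
      \<open>ps\<close>, so the coordinates of \<open>x\<close> can be read as a coefficient
      function on vectors.\<close>
    define a where "a v = x $ (THE i. i < n \<and> ps ! i = v)" for v
    have a: "a (ps ! i) = x $ i" if "i < n" for i
    proof -
      have "(THE j. j < n \<and> ps ! j = ps ! i) = i"
        using that len ps(2) by (intro the_equality) (auto simp: nth_eq_iff_index_eq)
      then show ?thesis by (simp add: a_def)
    qed
    then have xv: "x = vec n (\<lambda>i. a (ps ! i))" using x(2) by auto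
    have "a v = 0" if "v \<in> C - B" for v
    proof -
      have "v \<in> set ps" using that ps(1) by simp
      then obtain i where i: "i < n" "v = ps ! i" unfolding in_set_conv_nth len by blast
      then have "\<not> i < k" using that nthB by simp
      then show ?thesis using a x(3) i by simp
    qed
    then have "w = lincomb a B" unfolding x(1) by (subst xv, unfold mult) (rule eq, auto)
    then show "w \<in> W" using BW by auto
  qed
  then show thesis using that k P det by blast
qed

lemma mat_mult_unit_vec:
  fixes A :: "'a :: semiring_1 mat"
  assumes "A \<in> carrier_mat nr nc" "j < nc"
  shows "A *\<^sub>v unit_vec nc j = col A j"
  using assms by (intro eq_vecI) auto

text \<open>Conjugation by \<open>P\<close> moves \<open>W\<close> to the span of the first
  \<open>k\<close> unit vectors, so a matrix preserving \<open>W\<close> becomes block upper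
  triangular. \<open>P\<close> and \<open>Q\<close> are chosen before \<open>A\<close>, so one
  change of basis serves all matrices of a representation. Both \<open>k\<close> and
  \<open>l\<close> are positive because \<open>W\<close> is nonzero and proper.\<close>

lemma block_decomposition:
  assumes W: "is_subspace d W" "W \<noteq> {0\<^sub>v d}" "W \<noteq> carrier_vec d"
  obtains k l P Q where "0 < k" "0 < l" "k + l = d"
    "P \<in> carrier_mat d d" "Q \<in> carrier_mat d d" "P * Q = 1\<^sub>m d" "Q * P = 1\<^sub>m d"
    "\<And>A. A \<in> carrier_mat d d \<Longrightarrow> (\<And>v. v \<in> W \<Longrightarrow> A *\<^sub>v v \<in> W) \<Longrightarrow>
      \<exists>B C D. B \<in> carrier_mat k k \<and> C \<in> carrier_mat k l \<and> D \<in> carrier_mat l l \<and>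
        Q * A * P = four_block_mat B C (0\<^sub>m l k) D"
proof -
  interpret vec_space "TYPE(complex)" d .
  obtain k P where k: "k \<le> d" and P: "P \<in> carrier_mat d d" and "det P \<noteq> 0" and
    WP: "W = {P *\<^sub>v x | x. x \<in> carrier_vec d \<and> (\<forall>i<d. k \<le> i \<longrightarrow> x $ i = 0)}"
    by (rule adapted_basis[of W]) (use W(1) in \<open>auto simp: is_subspace_def\<close>)
  then obtain Q where Q: "Q \<in> carrier_mat d d" and PQ: "P * Q = 1\<^sub>m d" and QP: "Q * P = 1\<^sub>m d"
    using det_non_zero_imp_unit[OF P, of "()"] unfolding Units_def ring_mat_def by auto
  have WI: "P *\<^sub>v x \<in> W" if "x \<in> carrier_vec d" "\<And>i. i < d \<Longrightarrow> k \<le> i \<Longrightarrow> x $ i = 0" for x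
    unfolding WP using that by blast
  have "k \<noteq> 0"
  proof
    assume "k = 0"
    have "W \<subseteq> {0\<^sub>v d}"
    proof
      fix w assume "w \<in> W"
      then obtain x where x: "w = P *\<^sub>v x" "x \<in> carrier_vec d" "\<forall>i<d. x $ i = 0"
        using WP \<open>k = 0\<close> by auto
      then have "x = 0\<^sub>v d" by auto
      then show "w \<in> {0\<^sub>v d}" using x P by auto
    qed
    then show False using W unfolding is_subspace_def by auto
  qed
  moreover have "k \<noteq> d"
  proof
    assume "k = d"
    have "v \<in> W" if "v \<in> carrier_vec d" for v
    proof -
      have "v = P *\<^sub>v (Q *\<^sub>v v)" using that P Q PQ by (metis assoc_mult_mat_vec one_mult_mat_vec)
      moreover have "P *\<^sub>v (Q *\<^sub>v v) \<in> W" using that Q \<open>k = d\<close> by (intro WI) auto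
      ultimately show ?thesis by simp
    qed
    then show False using W unfolding is_subspace_def by auto
  qed
  ultimately have kl: "0 < k" "0 < d - k" "k + (d - k) = d" using k by auto
  have blk: "\<exists>B C D. B \<in> carrier_mat k k \<and> C \<in> carrier_mat k (d - k) \<and> D \<in> carrier_mat (d - k) (d - k) \<and>
        Q * A * P = four_block_mat B C (0\<^sub>m (d - k) k) D"
    if A: "A \<in> carrier_mat d d" and inv: "\<And>v. v \<in> W \<Longrightarrow> A *\<^sub>v v \<in> W" for A
  proof -
    define T where "T = Q * A * P"
    have T: "T \<in> carrier_mat d d" using A P Q by (auto simp: T_def)
    \<comment> \<open>Column \<open>j\<close> of \<open>T\<close> holds the new coordinates of the
      image under \<open>A\<close> of the \<open>j\<close>-th basis vector; for \<open>j < k\<close>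
      that vector lies in \<open>W\<close>, hence so does its image.\<close>
    have z: "T $$ (i, j) = 0" if "i < d" "k \<le> i" "j < k" for i j
    proof -
      have j: "j < d" using that k by auto
      have "P *\<^sub>v unit_vec d j \<in> W" using that by (intro WI) auto
      then have "A *\<^sub>v (P *\<^sub>v unit_vec d j) \<in> W" by (rule inv)
      then obtain x where x: "A *\<^sub>v (P *\<^sub>v unit_vec d j) = P *\<^sub>v x" "x \<in> carrier_vec d"
        "\<forall>i<d. k \<le> i \<longrightarrow> x $ i = 0" using WP by auto
      have "T *\<^sub>v unit_vec d j = Q *\<^sub>v (A *\<^sub>v (P *\<^sub>v unit_vec d j))"
        using A P Q assoc_mult_mat_vec[of "Q * A" d d P d "unit_vec d j"]
          assoc_mult_mat_vec[of Q d d A d "P *\<^sub>v unit_vec d j"] by (simp add: T_def)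
      also have "\<dots> = (Q * P) *\<^sub>v x" using x P Q assoc_mult_mat_vec[of Q d d P d x] by simp
      also have "\<dots> = x" using QP x by simp
      finally have "col T j = x" using mat_mult_unit_vec[OF T j] by simp
      then show ?thesis using x that T j by (metis carrier_matD index_col)
    qed
    obtain B C E D where s: "split_block T k k = (B, C, E, D)" by (metis prod_cases4)
    note sb = split_block[OF s, of "d - k" "d - k"]
    have dims: "dim_row T = k + (d - k)" "dim_col T = k + (d - k)" using T k by auto
    have "E = 0\<^sub>m (d - k) k"
      using s z T k unfolding split_block_def Let_def by (auto intro!: eq_matI)
    then show ?thesis using sb[OF dims] unfolding T_def by blast
  qed
  show thesis by (rule that[OF kl P Q PQ QP blk])
qed

subsection \<open>Matrices of finite order\<close>

lemma mat_trace_mult_comm: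
  assumes "A \<in> carrier_mat n m" "B \<in> carrier_mat m n"
  shows "mat_trace (A * B) = mat_trace (B * A)"
proof -
  have "mat_trace (A * B) = (\<Sum>i<n. \<Sum>j<m. A $$ (i, j) * B $$ (j, i))"
    using assms by (simp add: mat_trace_def scalar_prod_def atLeast0LessThan)
  also have "\<dots> = (\<Sum>j<m. \<Sum>i<n. B $$ (j, i) * A $$ (i, j))"
    by (subst sum.swap) (simp add: mult.commute)
  also have "\<dots> = mat_trace (B * A)"
    using assms by (simp add: mat_trace_def scalar_prod_def atLeast0LessThan)
  finally show ?thesis .
qed

lemma mat_trace_conjugate:
  assumes "A \<in> carrier_mat n n" "P \<in> carrier_mat n n" "Q \<in> carrier_mat n n" "P * Q = 1\<^sub>m n"
  shows "mat_trace (Q * A * P) = mat_trace A"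
proof -
  have "mat_trace (Q * A * P) = mat_trace (P * (Q * A))"
    using assms by (intro mat_trace_mult_comm[of _ n n]) auto
  also have "P * (Q * A) = (P * Q) * A" using assms by (intro assoc_mult_mat[symmetric]) auto
  also have "\<dots> = A" unfolding assms(4) using assms(1) by simp
  finally show ?thesis .
qed

lemma mat_trace_four_block:
  assumes "B \<in> carrier_mat k k" "D \<in> carrier_mat l l"
  shows "mat_trace (four_block_mat B C E D) = mat_trace B + mat_trace D"
proof -
  have "mat_trace (four_block_mat B C E D) =
      (\<Sum>i<k + l. if i < k then B $$ (i, i) else D $$ (i - k, i - k))"
    unfolding mat_trace_def using assms by (intro sum.cong) auto
  also have "\<dots> = (\<Sum>i<k. B $$ (i, i)) + (\<Sum>i<l. D $$ (i, i))"
  proof (induction l)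
    case (Suc l)
    then show ?case by simp
  qed simp
  finally show ?thesis using assms by (simp add: mat_trace_def)
qed

lemma mat_trace_smult_one: "mat_trace (c \<cdot>\<^sub>m 1\<^sub>m n) = of_nat n * c"
  by (simp add: mat_trace_def)

lemma scalar_if_conjugate_scalar:
  assumes "A \<in> carrier_mat n n" "P \<in> carrier_mat n n" "Q \<in> carrier_mat n n"
    "P * Q = 1\<^sub>m n" "Q * A * P = c \<cdot>\<^sub>m 1\<^sub>m n"
  shows "A = (c :: 'a :: comm_ring_1) \<cdot>\<^sub>m 1\<^sub>m n"
proof -
  have "P * (Q * A * P) * Q = (P * Q) * A * (P * Q)"
    using assms(1-3) by (simp add: assoc_mult_mat[of _ n n _ n _ n])
  also have "\<dots> = A" using assms by simp
  finally have "A = P * (c \<cdot>\<^sub>m 1\<^sub>m n) * Q" using assms(5) by simp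
  also have "P * (c \<cdot>\<^sub>m 1\<^sub>m n) = c \<cdot>\<^sub>m P" using assms(2) by (simp add: mult_smult_distrib[of _ n n _ n])
  also have "(c \<cdot>\<^sub>m P) * Q = c \<cdot>\<^sub>m (P * Q)" using assms(2,3) by (simp add: mult_smult_assoc_mat[of _ n n _ n])
  finally show ?thesis using assms(4) by simp
qed

section \<open>Powers of block upper triangular matrices\<close>

lemma pow_upper_block_mat:
  assumes "B \<in> carrier_mat k k" "C \<in> carrier_mat k l" "D \<in> carrier_mat l l"
  obtains E where "E \<in> carrier_mat k l"
    "four_block_mat B C (0\<^sub>m l k) D ^\<^sub>m n = four_block_mat (B ^\<^sub>m n) E (0\<^sub>m l k) (D ^\<^sub>m n)"
proof (induction n arbitrary: thesis)
  case 0
  show ?case by (rule 0[of "0\<^sub>m k l"]) (use assms in auto)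
next
  case (Suc n)
  obtain E where E: "E \<in> carrier_mat k l"
    "four_block_mat B C (0\<^sub>m l k) D ^\<^sub>m n = four_block_mat (B ^\<^sub>m n) E (0\<^sub>m l k) (D ^\<^sub>m n)"
    using Suc.IH .
  have Bn: "B ^\<^sub>m n \<in> carrier_mat k k" "D ^\<^sub>m n \<in> carrier_mat l l" using assms by auto
  have z: "0\<^sub>m l k \<in> carrier_mat l k" by simp
  show ?case
  proof (rule Suc.prems)
    show "B ^\<^sub>m n * C + E * D \<in> carrier_mat k l" using assms E Bn by auto
    show "four_block_mat B C (0\<^sub>m l k) D ^\<^sub>m Suc n =
        four_block_mat (B ^\<^sub>m Suc n) (B ^\<^sub>m n * C + E * D) (0\<^sub>m l k) (D ^\<^sub>m Suc n)"
      using assms E Bn left_add_zero_mat[OF mult_carrier_mat[OF Bn(2) assms(3)]]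
        right_add_zero_mat[OF mult_carrier_mat[OF Bn(1) assms(1)]]
      by (simp add: mult_four_block_mat[OF Bn(1) E(1) z Bn(2) assms(1,2) z assms(3)])
  qed
qed

text \<open>Blocks are determined by the matrix once their sizes are fixed, which the carrier
  hypotheses do. The lower left block is absent from the conclusion, as it is zero in every
  application.\<close>

lemma four_block_mat_inject:
  assumes eq: "four_block_mat A1 B1 C1 D1 = four_block_mat A2 B2 C2 D2"
    and A: "A1 \<in> carrier_mat k k" "A2 \<in> carrier_mat k k"
    and B: "B1 \<in> carrier_mat k l" "B2 \<in> carrier_mat k l"
    and D: "D1 \<in> carrier_mat l l" "D2 \<in> carrier_mat l l"
  shows "A1 = A2" "B1 = B2" "D1 = D2"
proof -
  have e: "four_block_mat A1 B1 C1 D1 $$ (i, j) = four_block_mat A2 B2 C2 D2 $$ (i, j)" for i j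
    using eq by simp
  show "A1 = A2"
  proof (rule eq_matI)
    fix i j assume "i < dim_row A2" "j < dim_col A2"
    then show "A1 $$ (i, j) = A2 $$ (i, j)" using e[of i j] A D by simp
  qed (use A in auto)
  show "B1 = B2"
  proof (rule eq_matI)
    fix i j assume "i < dim_row B2" "j < dim_col B2"
    then show "B1 $$ (i, j) = B2 $$ (i, j)" using e[of i "j + k"] A B D by simp
  qed (use B in auto)
  show "D1 = D2"
  proof (rule eq_matI)
    fix i j assume "i < dim_row D2" "j < dim_col D2"
    then show "D1 $$ (i, j) = D2 $$ (i, j)" using e[of "i + k" "j + k"] A B D by simp
  qed (use D in auto)
qed

text \<open>The matrix is \<open>a\<close> times the identity plus a part of square zero, so the
  binomial expansion stops after the linear term. The exponent is a successor so that
  \<open>a ^ n\<close> can be written without subtraction.\<close>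

lemma pow_upper_block_scalar:
  fixes a :: "'a :: comm_ring_1"
  assumes C: "C \<in> carrier_mat k l"
  shows "four_block_mat (a \<cdot>\<^sub>m 1\<^sub>m k) C (0\<^sub>m l k) (a \<cdot>\<^sub>m 1\<^sub>m l) ^\<^sub>m Suc n =
    four_block_mat (a ^ Suc n \<cdot>\<^sub>m 1\<^sub>m k) ((of_nat (Suc n) * a ^ n) \<cdot>\<^sub>m C) (0\<^sub>m l k) (a ^ Suc n \<cdot>\<^sub>m 1\<^sub>m l)"
    (is "?T ^\<^sub>m _ = _")
proof (induction n)
  case 0
  have "?T \<in> carrier_mat (k + l) (k + l)" by simp
  then show ?case using C by (auto intro!: cong_four_block_mat)
next
  case (Suc n)
  have c: "b \<cdot>\<^sub>m 1\<^sub>m j \<in> carrier_mat j j" "b \<cdot>\<^sub>m C \<in> carrier_mat k l" for j and b :: 'a using C by auto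
  have "?T ^\<^sub>m Suc (Suc n) = ?T ^\<^sub>m Suc n * ?T" by simp
  also have "\<dots> = four_block_mat (a ^ Suc n \<cdot>\<^sub>m 1\<^sub>m k) ((of_nat (Suc n) * a ^ n) \<cdot>\<^sub>m C) (0\<^sub>m l k) (a ^ Suc n \<cdot>\<^sub>m 1\<^sub>m l) * ?T"
    by (simp only: Suc.IH)
  also have "\<dots> = four_block_mat (a ^ Suc (Suc n) \<cdot>\<^sub>m 1\<^sub>m k) ((of_nat (Suc (Suc n)) * a ^ Suc n) \<cdot>\<^sub>m C)
      (0\<^sub>m l k) (a ^ Suc (Suc n) \<cdot>\<^sub>m 1\<^sub>m l)"
    unfolding mult_four_block_mat[OF c(1) c(2) zero_carrier_mat c(1) c(1) C zero_carrier_mat c(1)]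
    using C
    by (intro cong_four_block_mat)
      (auto simp: mult_smult_distrib[of _ k k _ k] mult_smult_distrib[of _ l l _ l] mult_smult_distrib[of _ k l _ l] mult_smult_assoc_mat[of _ k k _ l] algebra_simps
        intro!: eq_matI)
  finally show ?case .
qed

text \<open>The upper right block of the \<open>m\<close>-th power is \<open>m * a ^ (m - 1)\<close>
  times \<open>C\<close> and must vanish. In characteristic zero the factor is nonzero, so
  \<open>C\<close> is zero.\<close>

lemma finite_order_upper_block_scalar:
  fixes a :: "'a :: field_char_0"
  assumes C: "C \<in> carrier_mat k l" and k: "0 < k" and m: "0 < m"
    and one: "four_block_mat (a \<cdot>\<^sub>m 1\<^sub>m k) C (0\<^sub>m l k) (a \<cdot>\<^sub>m 1\<^sub>m l) ^\<^sub>m m = 1\<^sub>m (k + l)"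
  shows "four_block_mat (a \<cdot>\<^sub>m 1\<^sub>m k) C (0\<^sub>m l k) (a \<cdot>\<^sub>m 1\<^sub>m l) = a \<cdot>\<^sub>m 1\<^sub>m (k + l)"
proof -
  obtain n where n: "m = Suc n" using m by (cases m) auto
  have "four_block_mat (a ^ Suc n \<cdot>\<^sub>m 1\<^sub>m k) ((of_nat (Suc n) * a ^ n) \<cdot>\<^sub>m C) (0\<^sub>m l k) (a ^ Suc n \<cdot>\<^sub>m 1\<^sub>m l)
      = four_block_mat (1\<^sub>m k) (0\<^sub>m k l) (0\<^sub>m l k) (1\<^sub>m l)"
    using one pow_upper_block_scalar[OF C, of a n] unfolding n by simp
  note inj = four_block_mat_inject[OF this, of k l]
  \<comment> \<open>The corner entry exists since \<open>k\<close> is positive; it shows that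
    \<open>a\<close> is a root of unity, hence nonzero.\<close>
  have "(a ^ Suc n \<cdot>\<^sub>m 1\<^sub>m k) $$ (0, 0) = (1\<^sub>m k :: 'a mat) $$ (0, 0)" using inj(1) C by simp
  then have "a ^ Suc n = 1" using k by simp
  then have "a \<noteq> 0" by auto
  then have nz: "of_nat (Suc n) * a ^ n \<noteq> 0" by (simp del: of_nat_Suc)
  have eq: "(of_nat (Suc n) * a ^ n) \<cdot>\<^sub>m C = 0\<^sub>m k l" using inj(2) C by simp
  have "C = 0\<^sub>m k l"
  proof (rule eq_matI)
    fix i j assume ij: "i < dim_row (0\<^sub>m k l :: 'a mat)" "j < dim_col (0\<^sub>m k l :: 'a mat)"
    then have "((of_nat (Suc n) * a ^ n) \<cdot>\<^sub>m C) $$ (i, j) = 0" unfolding eq by simp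
    then show "C $$ (i, j) = 0\<^sub>m k l $$ (i, j)" using nz ij C \<open>a \<noteq> 0\<close> by simp
  qed (use C in auto)
  then show ?thesis by (auto intro!: eq_matI)
qed

lemma conjugate_pow:
  assumes "A \<in> carrier_mat n n" "P \<in> carrier_mat n n" "Q \<in> carrier_mat n n" "P * Q = 1\<^sub>m n" "Q * P = 1\<^sub>m n"
  shows "(Q * A * P) ^\<^sub>m m = Q * A ^\<^sub>m m * P"
proof -
  have "similar_mat_wit (Q * A * P) A Q P"
    using assms by (intro similar_mat_witI[of _ _ n]) auto
  then show ?thesis by (rule similar_mat_wit_pow_id)
qed

section \<open>Eigenspaces, scalar matrices and the trace bound\<close>

lemma eigenspace_subspace:
  assumes "A \<in> carrier_mat d d"
  shows "is_subspace d {v \<in> carrier_vec d. A *\<^sub>v v = c \<cdot>\<^sub>v v}"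
  using assms unfolding is_subspace_def
  by (auto simp: mult_add_distrib_mat_vec[of _ d d] smult_add_distrib_vec[of _ d] mult_mat_vec[of _ d d] smult_smult_assoc mult.commute)

lemma eigenvector_exists:
  assumes "(A :: complex mat) \<in> carrier_mat d d" "0 < d"
  obtains c v where "v \<in> carrier_vec d" "v \<noteq> 0\<^sub>v d" "A *\<^sub>v v = c \<cdot>\<^sub>v v"
  using spectrum_non_empty[OF assms] assms
  unfolding spectrum_def eigenvalue_def eigenvector_def by auto

lemma mat_eq_smult_oneI:
  assumes A: "A \<in> carrier_mat d d" and eig: "\<And>v. v \<in> carrier_vec d \<Longrightarrow> A *\<^sub>v v = c \<cdot>\<^sub>v v"
  shows "A = (c :: 'a :: comm_ring_1) \<cdot>\<^sub>m 1\<^sub>m d"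
proof (rule eq_matI)
  fix i j assume "i < dim_row (c \<cdot>\<^sub>m 1\<^sub>m d :: 'a mat)" "j < dim_col (c \<cdot>\<^sub>m 1\<^sub>m d :: 'a mat)"
  then have ij: "i < d" "j < d" by auto
  have "col A j $ i = (c \<cdot>\<^sub>v unit_vec d j) $ i"
    using eig[of "unit_vec d j"] mat_mult_unit_vec[OF A ij(2)] by simp
  then show "A $$ (i, j) = (c \<cdot>\<^sub>m 1\<^sub>m d) $$ (i, j)" using ij A by auto
qed (use A in auto)

lemma pow_smult_one_mat: "(c \<cdot>\<^sub>m 1\<^sub>m n) ^\<^sub>m m = (c :: 'a :: comm_ring_1) ^ m \<cdot>\<^sub>m 1\<^sub>m n"
  by (induction m) (auto simp: mult_smult_distrib[of _ n n _ n] mult_smult_assoc_mat[of _ n n _ n] mult.commute intro!: eq_matI)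

lemma smult_one_mat_eq_one:
  assumes "c \<cdot>\<^sub>m 1\<^sub>m n = (1\<^sub>m n :: 'a :: comm_ring_1 mat)" "0 < n"
  shows "c = 1"
proof -
  have "(c \<cdot>\<^sub>m 1\<^sub>m n) $$ (0, 0) = (1\<^sub>m n :: 'a mat) $$ (0, 0)" unfolding assms(1) ..
  then show ?thesis using assms(2) by simp
qed

text \<open>Powers act separately on the diagonal blocks, so both blocks inherit the finite order;
  this feeds the induction on the size in \<open>finite_order_trace\<close>.\<close>

lemma finite_order_block_diagonal:
  fixes B D :: "'a :: comm_ring_1 mat"
  assumes "B \<in> carrier_mat k k" "C \<in> carrier_mat k l" "D \<in> carrier_mat l l"
    and "four_block_mat B C (0\<^sub>m l k) D ^\<^sub>m m = 1\<^sub>m (k + l)"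
  shows "B ^\<^sub>m m = 1\<^sub>m k" "D ^\<^sub>m m = 1\<^sub>m l"
proof -
  obtain E where E: "E \<in> carrier_mat k l"
    "four_block_mat B C (0\<^sub>m l k) D ^\<^sub>m m = four_block_mat (B ^\<^sub>m m) E (0\<^sub>m l k) (D ^\<^sub>m m)"
    by (rule pow_upper_block_mat[OF assms(1-3)])
  have "four_block_mat (B ^\<^sub>m m) E (0\<^sub>m l k) (D ^\<^sub>m m) = four_block_mat (1\<^sub>m k) (0\<^sub>m k l) (0\<^sub>m l k) (1\<^sub>m l)"
    using E(2) assms(4) by simp
  from four_block_mat_inject[OF this, of k l] show "B ^\<^sub>m m = 1\<^sub>m k" "D ^\<^sub>m m = 1\<^sub>m l"
    using assms E by auto
qed

text \<open>Equality in the triangle inequality makes the two summands point in the same direction,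
  and \<open>b\<close> and \<open>e\<close> are their directions.\<close>

lemma unit_complex_eq_of_norm_add:
  fixes b e :: complex
  assumes "cmod b = 1" "cmod e = 1" "0 < k" "0 < l" "cmod (of_nat k * b + of_nat l * e) = k + l"
  shows "b = e"
proof -
  have n: "cmod (of_nat k * b) = k" "cmod (of_nat l * e) = l" using assms by (simp_all add: norm_mult)
  then have "cmod (of_nat k * b) *\<^sub>R (of_nat l * e) = cmod (of_nat l * e) *\<^sub>R (of_nat k * b)"
    using assms(5) by (subst norm_triangle_eq[symmetric]) simp
  then have "of_nat k * of_nat l * e = of_nat k * of_nat l * b"
    unfolding n by (simp add: scaleR_conv_of_real mult_ac)
  then show ?thesis using assms by simp
qed

text \<open>The trace is a sum of \<open>d\<close> roots of unity, but no diagonalisation is used: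
  induction on \<open>d\<close> splits along an eigenspace of \<open>A\<close>. If this is
  everything, \<open>A\<close> is scalar; otherwise both diagonal blocks are smaller and of finite
  order.\<close>

lemma finite_order_trace:
  assumes "A \<in> carrier_mat d d" "0 < d" "A ^\<^sub>m m = 1\<^sub>m d" "0 < m"
  shows "cmod (mat_trace A) \<le> d \<and>
    (cmod (mat_trace A) = d \<longrightarrow> (\<exists>c. cmod c = 1 \<and> A = c \<cdot>\<^sub>m 1\<^sub>m d))"
  using assms
proof (induction d arbitrary: A rule: less_induct)
  case (less d)
  note A = less.prems(1)
  obtain c v where v: "v \<in> carrier_vec d" "v \<noteq> 0\<^sub>v d" "A *\<^sub>v v = c \<cdot>\<^sub>v v"
    by (rule eigenvector_exists[OF A less.prems(2)])
  define W where "W = {v \<in> carrier_vec d. A *\<^sub>v v = c \<cdot>\<^sub>v v}"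
  have W: "is_subspace d W" unfolding W_def by (rule eigenspace_subspace[OF A])
  have W0: "W \<noteq> {0\<^sub>v d}" using v by (auto simp: W_def)
  show ?case
  proof (cases "W = carrier_vec d")
    case True
    have Ac: "A = c \<cdot>\<^sub>m 1\<^sub>m d"
      by (rule mat_eq_smult_oneI[OF A]) (use True in \<open>auto simp: W_def\<close>)
    then have "c ^ m = 1"
      using less.prems smult_one_mat_eq_one[of "c ^ m" d] by (simp add: pow_smult_one_mat)
    then have "cmod c = 1" using power_eq_1_iff[of c m] less.prems(4) by auto
    then show ?thesis using Ac by (auto simp: mat_trace_smult_one norm_mult)
  next
    case False
    obtain k l P Q where kl: "0 < k" "0 < l" "k + l = d" and
      PQ: "P \<in> carrier_mat d d" "Q \<in> carrier_mat d d" "P * Q = 1\<^sub>m d" "Q * P = 1\<^sub>m d" and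
      blk: "\<And>A. A \<in> carrier_mat d d \<Longrightarrow> (\<And>v. v \<in> W \<Longrightarrow> A *\<^sub>v v \<in> W) \<Longrightarrow>
      \<exists>B C D. B \<in> carrier_mat k k \<and> C \<in> carrier_mat k l \<and> D \<in> carrier_mat l l \<and>
        Q * A * P = four_block_mat B C (0\<^sub>m l k) D"
      by (rule block_decomposition[OF W W0 False]) blast
    have "A *\<^sub>v w \<in> W" if "w \<in> W" for w
      using that W unfolding is_subspace_def by (auto simp: W_def)
    then obtain B C D where BCD: "B \<in> carrier_mat k k" "C \<in> carrier_mat k l" "D \<in> carrier_mat l l"
      and T: "Q * A * P = four_block_mat B C (0\<^sub>m l k) D"
      using blk[OF A] by blast
    have "(Q * A * P) ^\<^sub>m m = 1\<^sub>m d"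
      unfolding conjugate_pow[OF A PQ] less.prems(3) using PQ by simp
    then have one: "four_block_mat B C (0\<^sub>m l k) D ^\<^sub>m m = 1\<^sub>m (k + l)" using T kl by simp
    note BD = finite_order_block_diagonal[OF BCD one]
    have IHB: "cmod (mat_trace B) \<le> k" "cmod (mat_trace B) = k \<Longrightarrow> \<exists>c. cmod c = 1 \<and> B = c \<cdot>\<^sub>m 1\<^sub>m k"
      using less.IH[of k B] kl BCD BD less.prems(4) by auto
    have IHD: "cmod (mat_trace D) \<le> l" "cmod (mat_trace D) = l \<Longrightarrow> \<exists>c. cmod c = 1 \<and> D = c \<cdot>\<^sub>m 1\<^sub>m l"
      using less.IH[of l D] kl BCD BD less.prems(4) by auto
    have tr: "mat_trace A = mat_trace B + mat_trace D"
      using mat_trace_conjugate[OF A PQ(1-3)] mat_trace_four_block[OF BCD(1,3)] T by simp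
    have tri: "cmod (mat_trace A) \<le> cmod (mat_trace B) + cmod (mat_trace D)"
      unfolding tr by (rule norm_triangle_ineq)
    have d: "real d = real k + real l" using kl by auto
    have "\<exists>c. cmod c = 1 \<and> A = c \<cdot>\<^sub>m 1\<^sub>m d" if eq: "cmod (mat_trace A) = d"
    proof -
      \<comment> \<open>The bounds for the two blocks add up to \<open>d\<close>, so equality for
        \<open>A\<close> forces equality in both.\<close>
      obtain b e where b: "cmod b = 1" "B = b \<cdot>\<^sub>m 1\<^sub>m k" and e: "cmod e = 1" "D = e \<cdot>\<^sub>m 1\<^sub>m l"
        using IHB IHD tri eq d by (metis add_le_cancel_left add_le_cancel_right add_mono order_antisym order_trans)
      have "cmod (of_nat k * b + of_nat l * e) = k + l"
        using eq tr d b e by (simp add: mat_trace_smult_one)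
      then have "b = e" using unit_complex_eq_of_norm_add b(1) e(1) kl by blast
      \<comment> \<open>The diagonal now carries a single scalar, and finite order kills the upper
        right block.\<close>
      then have "Q * A * P = b \<cdot>\<^sub>m 1\<^sub>m d"
        using finite_order_upper_block_scalar[OF BCD(2) kl(1) less.prems(4), of b] one T b e kl(3) by simp
      then show ?thesis using scalar_if_conjugate_scalar[OF A PQ(1-3)] b(1) by blast
    qed
    then show ?thesis using tri IHB(1) IHD(1) d by auto
  qed
qed

subsection \<open>Representations and centers of characters\<close>

lemma is_repD:
  assumes "is_rep G d \<rho>"
  shows "0 < d" "g \<in> carrier G \<Longrightarrow> \<rho> g \<in> carrier_mat d d" "\<rho> \<one>\<^bsub>G\<^esub> = 1\<^sub>m d"
    "g \<in> carrier G \<Longrightarrow> h \<in> carrier G \<Longrightarrow> \<rho> (g \<otimes>\<^bsub>G\<^esub> h) = \<rho> g * \<rho> h"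
  using assms unfolding is_rep_def by auto

text \<open>The group order is an exponent that serves all elements at once, by Lagrange's
  theorem.\<close>

lemma (in group) rep_finite_order:
  assumes \<rho>: "is_rep G d \<rho>" and g: "g \<in> carrier G"
  shows "\<rho> g ^\<^sub>m Coset.order G = 1\<^sub>m d"
proof -
  have "\<rho> (g [^] m) = \<rho> g ^\<^sub>m m" for m :: nat
    using is_repD[OF \<rho>] g by (induction m) auto
  then show ?thesis using pow_order_eq_1[OF g] is_repD(3)[OF \<rho>] by metis
qed

text \<open>The kernel of the representation itself; it stands for the kernel of the character that
  \<open>\<rho>\<close> affords.\<close>

definition rep_kernel :: "('a, 'b) monoid_scheme \<Rightarrow> nat \<Rightarrow> ('a \<Rightarrow> complex mat) \<Rightarrow> 'a set" where
  "rep_kernel G d \<rho> = {g \<in> carrier G. \<rho> g = 1\<^sub>m d}"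

lemma (in group) rep_mult_inv:
  assumes \<rho>: "is_rep G d \<rho>" and g: "g \<in> carrier G"
  shows "\<rho> g * \<rho> (inv g) = 1\<^sub>m d" "\<rho> (inv g) * \<rho> g = 1\<^sub>m d"
  using is_repD(3)[OF \<rho>] is_repD(4)[OF \<rho>, of g "inv g"] is_repD(4)[OF \<rho>, of "inv g" g] g by auto

lemma (in group) rep_kernel_normal:
  assumes \<rho>: "is_rep G d \<rho>"
  shows "rep_kernel G d \<rho> \<lhd> G"
  unfolding normal_inv_iff
proof (intro conjI ballI)
  note r = is_repD[OF \<rho>]
  show "subgroup (rep_kernel G d \<rho>) G"
  proof (rule subgroupI)
    show "rep_kernel G d \<rho> \<noteq> {}" using r by (auto simp: rep_kernel_def)
    fix a assume "a \<in> rep_kernel G d \<rho>"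
    then show "inv a \<in> rep_kernel G d \<rho>"
      using rep_mult_inv(1)[OF \<rho>, of a] r(2)[of "inv a"] by (auto simp: rep_kernel_def)
  qed (use r in \<open>auto simp: rep_kernel_def\<close>)
  fix x h assume x: "x \<in> carrier G" and "h \<in> rep_kernel G d \<rho>"
  then have h: "h \<in> carrier G" "\<rho> h = 1\<^sub>m d" by (auto simp: rep_kernel_def)
  have "\<rho> (x \<otimes> h \<otimes> inv x) = \<rho> x * \<rho> (inv x)" using x h r right_mult_one_mat[OF r(2)[OF x]] by simp
  then show "x \<otimes> h \<otimes> inv x \<in> rep_kernel G d \<rho>"
    using x h rep_mult_inv[OF \<rho> x] by (simp add: rep_kernel_def)
qed

text \<open>The value at the identity is the degree \<open>d\<close>, so membership says that the
  trace has modulus \<open>d\<close>. This forces a scalar by \<open>finite_order_trace\<close>;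
  conversely a scalar of finite order has modulus one.\<close>

lemma (in group) char_center_eq_scalars:
  assumes \<rho>: "is_rep G d \<rho>" and fin: "finite (carrier G)"
  shows "char_center G (character G \<rho>) = {g \<in> carrier G. \<exists>c. \<rho> g = c \<cdot>\<^sub>m 1\<^sub>m d}"
proof -
  note r = is_repD[OF \<rho>]
  \<comment> \<open>\<open>order\<close> is 0 on an infinite carrier; finiteness makes the exponent
    positive, as the trace bound requires.\<close>
  have m: "0 < Coset.order G" using fin order_gt_0_iff_finite by blast
  have one: "character G \<rho> \<one> = d"
    using r(3) mat_trace_smult_one[of 1 d] by (simp add: character_def mat_trace_def)
  have eq: "complex_of_real (cmod (mat_trace (\<rho> g))) = of_nat d \<longleftrightarrow> cmod (mat_trace (\<rho> g)) = d" for g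
    by (metis of_real_eq_iff of_real_of_nat_eq)
  have "cmod (mat_trace (\<rho> g)) = d \<longleftrightarrow> (\<exists>c. \<rho> g = c \<cdot>\<^sub>m 1\<^sub>m d)" if g: "g \<in> carrier G" for g
  proof
    assume "cmod (mat_trace (\<rho> g)) = d"
    then show "\<exists>c. \<rho> g = c \<cdot>\<^sub>m 1\<^sub>m d"
      using finite_order_trace[OF r(2)[OF g] r(1) rep_finite_order[OF \<rho> g] m] by blast
  next
    assume "\<exists>c. \<rho> g = c \<cdot>\<^sub>m 1\<^sub>m d"
    then obtain c where c: "\<rho> g = c \<cdot>\<^sub>m 1\<^sub>m d" by blast
    then have "c ^ Coset.order G = 1"
      using rep_finite_order[OF \<rho> g] smult_one_mat_eq_one[OF _ r(1)] by (simp add: pow_smult_one_mat)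
    then have "cmod c = 1" using power_eq_1_iff[of c "Coset.order G"] m by auto
    then show "cmod (mat_trace (\<rho> g)) = d" unfolding c mat_trace_smult_one by (simp add: norm_mult)
  qed
  then show ?thesis unfolding char_center_def one using eq by (auto simp: character_def)
qed

text \<open>An eigenspace of \<open>A\<close> is invariant under every matrix commuting with
  \<open>A\<close>. Being nonzero, it is the whole space by irreducibility.\<close>

lemma schur_lemma:
  assumes irr: "irreducible_rep G d \<rho>" and A: "A \<in> carrier_mat d d"
    and comm: "\<And>g. g \<in> carrier G \<Longrightarrow> A * \<rho> g = \<rho> g * A"
  obtains c where "A = c \<cdot>\<^sub>m 1\<^sub>m d"
proof -
  have \<rho>: "is_rep G d \<rho>" using irr unfolding irreducible_rep_def by blast
  note r = is_repD[OF \<rho>]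
  obtain c v where v: "v \<in> carrier_vec d" "v \<noteq> 0\<^sub>v d" "A *\<^sub>v v = c \<cdot>\<^sub>v v"
    by (rule eigenvector_exists[OF A r(1)])
  define W where "W = {v \<in> carrier_vec d. A *\<^sub>v v = c \<cdot>\<^sub>v v}"
  have W: "is_subspace d W" unfolding W_def by (rule eigenspace_subspace[OF A])
  have "\<rho> g *\<^sub>v w \<in> W" if g: "g \<in> carrier G" and w: "w \<in> W" for g w
  proof -
    have w': "w \<in> carrier_vec d" "A *\<^sub>v w = c \<cdot>\<^sub>v w" using w by (auto simp: W_def)
    have "A *\<^sub>v (\<rho> g *\<^sub>v w) = (\<rho> g * A) *\<^sub>v w"
      using comm[OF g] assoc_mult_mat_vec[OF A r(2)[OF g] w'(1)] by simp
    also have "\<dots> = c \<cdot>\<^sub>v (\<rho> g *\<^sub>v w)"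
      using w' assoc_mult_mat_vec[OF r(2)[OF g] A w'(1)] mult_mat_vec[OF r(2)[OF g] w'(1)] by simp
    finally show ?thesis using r(2)[OF g] w' by (auto simp: W_def)
  qed
  then have "W = {0\<^sub>v d} \<or> W = carrier_vec d" using irr W unfolding irreducible_rep_def by blast
  moreover have "v \<in> W" using v by (simp add: W_def)
  ultimately have "W = carrier_vec d" using v by auto
  then have "A = c \<cdot>\<^sub>m 1\<^sub>m d" by (intro mat_eq_smult_oneI[OF A]) (auto simp: W_def)
  then show thesis by (rule that)
qed

text \<open>The cosets of \<open>g\<close> and \<open>h\<close> commute iff \<open>gh\<close> and
  \<open>hg\<close> lie in the same coset, and \<open>(gh)(hg)^-1\<close> is the commutator of
  \<open>g\<close> and \<open>h\<close>. This turns the center of a quotient into a condition inside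
  \<open>G\<close> that is visibly monotone in \<open>N\<close>.\<close>

lemma (in group) Zq_iff_commutator:
  assumes "N \<lhd> G"
  shows "Zq G N = {g \<in> carrier G. \<forall>h \<in> carrier G. (g \<otimes> h) \<otimes> inv (h \<otimes> g) \<in> N}"
proof -
  interpret normal N G by fact
  have c: "N #> x = N #> y \<longleftrightarrow> x \<otimes> inv y \<in> N" if "x \<in> carrier G" "y \<in> carrier G" for x y
    using rcos_module[OF is_group that(2,1)] rcos_self[OF that(1) subgroup_axioms]
      repr_independence[OF _ that(2) subgroup_axioms, of x] by auto
  have key: "(N #> g) <#> (N #> h) = (N #> h) <#> (N #> g) \<longleftrightarrow> (g \<otimes> h) \<otimes> inv (h \<otimes> g) \<in> N"
    if "g \<in> carrier G" "h \<in> carrier G" for g h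
    using that c[of "g \<otimes> h" "h \<otimes> g"] by (simp add: rcos_sum del: inv_mult_group)
  show ?thesis
    unfolding Zq_def quot_center_def carrier_FactGroup
    using key by (auto simp del: inv_mult_group)
qed

text \<open>Being central modulo the kernel means that the matrix commutes with the whole image,
  which by Schur's lemma means that it is scalar.\<close>

lemma (in group) char_center_eq_Zq_kernel:
  assumes irr: "irreducible_rep G d \<rho>" and fin: "finite (carrier G)"
  shows "char_center G (character G \<rho>) = Zq G (rep_kernel G d \<rho>)"
proof -
  have \<rho>: "is_rep G d \<rho>" using irr unfolding irreducible_rep_def by blast
  note r = is_repD[OF \<rho>]
  have k: "(g \<otimes> h) \<otimes> inv (h \<otimes> g) \<in> rep_kernel G d \<rho> \<longleftrightarrow> \<rho> g * \<rho> h = \<rho> h * \<rho> g"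
    if "g \<in> carrier G" "h \<in> carrier G" for g h
  proof -
    have e: "\<rho> (g \<otimes> h \<otimes> inv (h \<otimes> g)) = \<rho> (g \<otimes> h) * \<rho> (inv (h \<otimes> g))" using that r by simp
    have i: "\<rho> (inv (h \<otimes> g)) * \<rho> (h \<otimes> g) = 1\<^sub>m d" "\<rho> (h \<otimes> g) * \<rho> (inv (h \<otimes> g)) = 1\<^sub>m d"
      using rep_mult_inv[OF \<rho>, of "h \<otimes> g"] that by auto
    have car: "\<rho> (g \<otimes> h) \<in> carrier_mat d d" "\<rho> (h \<otimes> g) \<in> carrier_mat d d"
      "\<rho> (inv (h \<otimes> g)) \<in> carrier_mat d d" using that by (auto intro!: r)
    have "\<rho> (g \<otimes> h) * \<rho> (inv (h \<otimes> g)) = 1\<^sub>m d \<longleftrightarrow> \<rho> (g \<otimes> h) = \<rho> (h \<otimes> g)"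
    proof
      assume "\<rho> (g \<otimes> h) * \<rho> (inv (h \<otimes> g)) = 1\<^sub>m d"
      then show "\<rho> (g \<otimes> h) = \<rho> (h \<otimes> g)"
        using assoc_mult_mat[OF car(1,3,2)] i(1) car by simp
    qed (use i in simp)
    then show ?thesis using e that r by (simp add: rep_kernel_def)
  qed
  have "(\<exists>c. \<rho> g = c \<cdot>\<^sub>m 1\<^sub>m d) \<longleftrightarrow> (\<forall>h \<in> carrier G. \<rho> g * \<rho> h = \<rho> h * \<rho> g)" if g: "g \<in> carrier G" for g
  proof
    assume "\<exists>c. \<rho> g = c \<cdot>\<^sub>m 1\<^sub>m d"
    then obtain c where c: "\<rho> g = c \<cdot>\<^sub>m 1\<^sub>m d" by blast
    show "\<forall>h \<in> carrier G. \<rho> g * \<rho> h = \<rho> h * \<rho> g"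
    proof
      fix h assume "h \<in> carrier G"
      then have "\<rho> h \<in> carrier_mat d d" by (rule r)
      then show "\<rho> g * \<rho> h = \<rho> h * \<rho> g"
        unfolding c by (simp add: mult_smult_distrib[of _ d d _ d] mult_smult_assoc_mat[of _ d d _ d])
    qed
  next
    assume "\<forall>h \<in> carrier G. \<rho> g * \<rho> h = \<rho> h * \<rho> g"
    then show "\<exists>c. \<rho> g = c \<cdot>\<^sub>m 1\<^sub>m d" using schur_lemma[OF irr r(2)[OF g]] by metis
  qed
  then show ?thesis
    unfolding char_center_eq_scalars[OF \<rho> fin] Zq_iff_commutator[OF rep_kernel_normal[OF \<rho>]]
    using k by auto
qed

text \<open>Scalar matrices are closed under products and inverses, and conjugation fixes
  them.\<close>

lemma (in group) char_center_normal:
  assumes irr: "irreducible_rep G d \<rho>" and fin: "finite (carrier G)"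
  shows "char_center G (character G \<rho>) \<lhd> G"
proof -
  have \<rho>: "is_rep G d \<rho>" using irr unfolding irreducible_rep_def by blast
  note r = is_repD[OF \<rho>]
  have sc: "(a \<cdot>\<^sub>m 1\<^sub>m d) * (b \<cdot>\<^sub>m 1\<^sub>m d) = (a * b) \<cdot>\<^sub>m (1\<^sub>m d :: complex mat)" for a b
    by (simp add: mult_smult_distrib[of _ d d _ d] mult_smult_assoc_mat[of _ d d _ d]) (auto intro!: eq_matI)
  show ?thesis
    unfolding char_center_eq_scalars[OF \<rho> fin] normal_inv_iff
  proof (intro conjI ballI subgroupI)
    show "{g \<in> carrier G. \<exists>c. \<rho> g = c \<cdot>\<^sub>m 1\<^sub>m d} \<noteq> {}"
      using r(3) by (auto intro!: exI[of _ "\<one>"] exI[of _ 1])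
    fix g assume "g \<in> {g \<in> carrier G. \<exists>c. \<rho> g = c \<cdot>\<^sub>m 1\<^sub>m d}"
    then obtain c where g: "g \<in> carrier G" "\<rho> g = c \<cdot>\<^sub>m 1\<^sub>m d" by blast
    have ig: "\<rho> (inv g) \<in> carrier_mat d d" using g by (intro r) auto
    have "c \<cdot>\<^sub>m \<rho> (inv g) = 1\<^sub>m d"
      using rep_mult_inv(1)[OF \<rho> g(1)] ig unfolding g(2) by (simp add: mult_smult_assoc_mat[of _ d d _ d])
    moreover have "c \<noteq> 0"
    proof
      assume "c = 0"
      then have "(1\<^sub>m d :: complex mat) $$ (0, 0) = (0 \<cdot>\<^sub>m \<rho> (inv g)) $$ (0, 0)" using calculation by simp
      then show False using ig r(1) by simp
    qed
    moreover have "\<rho> (inv g) = (1 / c) \<cdot>\<^sub>m (c \<cdot>\<^sub>m \<rho> (inv g))" using \<open>c \<noteq> 0\<close> by (auto intro!: eq_matI)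
    ultimately show "inv g \<in> {g \<in> carrier G. \<exists>c. \<rho> g = c \<cdot>\<^sub>m 1\<^sub>m d}" using g by auto
    fix h assume "h \<in> {g \<in> carrier G. \<exists>c. \<rho> g = c \<cdot>\<^sub>m 1\<^sub>m d}"
    then obtain b where h: "h \<in> carrier G" "\<rho> h = b \<cdot>\<^sub>m 1\<^sub>m d" by blast
    show "g \<otimes> h \<in> {g \<in> carrier G. \<exists>c. \<rho> g = c \<cdot>\<^sub>m 1\<^sub>m d}" using g h r(4) sc by auto
  next
    fix x g assume x: "x \<in> carrier G" and "g \<in> {g \<in> carrier G. \<exists>c. \<rho> g = c \<cdot>\<^sub>m 1\<^sub>m d}"
    then obtain c where g: "g \<in> carrier G" "\<rho> g = c \<cdot>\<^sub>m 1\<^sub>m d" by blast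
    have car: "\<rho> x \<in> carrier_mat d d" "\<rho> (inv x) \<in> carrier_mat d d" using x by (auto intro!: r)
    have "\<rho> (x \<otimes> g \<otimes> inv x) = c \<cdot>\<^sub>m (\<rho> x * \<rho> (inv x))"
      using x g r(4) car by (simp add: mult_smult_distrib[of _ d d _ d] mult_smult_assoc_mat[of _ d d _ d])
    then show "x \<otimes> g \<otimes> inv x \<in> {g \<in> carrier G. \<exists>c. \<rho> g = c \<cdot>\<^sub>m 1\<^sub>m d}"
      using x g rep_mult_inv(1)[OF \<rho> x] by auto
  qed auto
qed

subsection \<open>Irreducible representations separate elements\<close>

text \<open>This is the left regular representation, written as permutation matrices through an
  enumeration \<open>e\<close> of the group. It is faithful because
  \<open>g \<otimes> e 0 = e 0\<close> forces \<open>g = \<one>\<close>.\<close>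

lemma (in group) regular_rep:
  assumes fin: "finite (carrier G)"
  obtains d \<rho> where "is_rep G d \<rho>" "\<And>g. g \<in> carrier G \<Longrightarrow> \<rho> g = 1\<^sub>m d \<Longrightarrow> g = \<one>"
proof -
  define d where "d = card (carrier G)"
  obtain e where e: "bij_betw e {0..<d} (carrier G)"
    using ex_bij_betw_nat_finite[OF fin] unfolding d_def by blast
  have e_in: "e i \<in> carrier G" if "i < d" for i using e that by (auto simp: bij_betw_def)
  have e_inj: "e i = e j \<longleftrightarrow> i = j" if "i < d" "j < d" for i j
    using e that by (auto simp: bij_betw_def inj_on_def)
  have e_surj: "\<exists>i<d. e i = g" if "g \<in> carrier G" for g
    using e that by (force simp: bij_betw_def image_iff)
  \<comment> \<open>Column \<open>j\<close> has its single 1 in the row \<open>i\<close> with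
    \<open>e i = g \<otimes> e j\<close>.\<close>
  define \<rho> where "\<rho> g = mat d d (\<lambda>(i, j). if e i = g \<otimes> e j then 1 else (0 :: complex))" for g
  have d: "0 < d" using fin by (auto simp: d_def card_gt_0_iff)
  have "is_rep G d \<rho>"
    unfolding is_rep_def
  proof (intro conjI ballI)
    show "\<rho> \<one> = 1\<^sub>m d" by (rule eq_matI) (auto simp: \<rho>_def e_in e_inj)
    fix g h assume g: "g \<in> carrier G" and h: "h \<in> carrier G"
    show "\<rho> (g \<otimes> h) = \<rho> g * \<rho> h"
    proof (rule eq_matI)
      fix i j assume "i < dim_row (\<rho> g * \<rho> h)" "j < dim_col (\<rho> g * \<rho> h)"
      then have ij: "i < d" "j < d" by (auto simp: \<rho>_def)
      \<comment> \<open>Only the summand at this index survives in the matrix product.\<close>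
      obtain k where k: "k < d" "e k = h \<otimes> e j" using e_surj[of "h \<otimes> e j"] h e_in ij by auto
      have "(\<rho> g * \<rho> h) $$ (i, j) =
          (\<Sum>l<d. (if e i = g \<otimes> e l then 1 else 0) * (if e l = h \<otimes> e j then 1 else 0))"
        using ij by (simp add: \<rho>_def scalar_prod_def atLeast0LessThan)
      also have "\<dots> = (\<Sum>l<d. if l = k then (if e i = g \<otimes> e k then 1 else 0) else 0)"
        using e_inj[OF _ k(1)] unfolding k(2)[symmetric] by (intro sum.cong) auto
      also have "\<dots> = (if e i = g \<otimes> e k then 1 else 0)" using k by simp
      also have "\<dots> = \<rho> (g \<otimes> h) $$ (i, j)" using ij k g h e_in by (simp add: \<rho>_def m_assoc)
      finally show "\<rho> (g \<otimes> h) $$ (i, j) = (\<rho> g * \<rho> h) $$ (i, j)" by simp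
    qed (auto simp: \<rho>_def)
  qed (auto simp: \<rho>_def d)
  moreover have "g = \<one>" if g: "g \<in> carrier G" and "\<rho> g = 1\<^sub>m d" for g
  proof -
    have "\<rho> g $$ (0, 0) = 1" using that d by simp
    then have "e 0 = g \<otimes> e 0" using d by (auto simp: \<rho>_def split: if_splits)
    then show ?thesis using g e_in[OF d] by (metis r_cancel_one')
  qed
  ultimately show thesis by (rule that)
qed

lemma rep_comp_hom:
  assumes "is_rep H d \<rho>" "group_hom G H f"
  shows "is_rep G d (\<lambda>g. \<rho> (f g))"
proof -
  interpret group_hom G H f by fact
  show ?thesis using assms(1) unfolding is_rep_def by auto
qed

text \<open>The regular representation of the quotient is faithful, so its pullback along the
  projection is trivial exactly on \<open>N\<close>.\<close>

lemma (in group) rep_with_kernel: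
  assumes "N \<lhd> G" and fin: "finite (carrier G)"
  obtains d \<rho> where "is_rep G d \<rho>" "rep_kernel G d \<rho> = N"
proof -
  interpret N: normal N G by fact
  interpret Q: group "G Mod N" by (rule N.factorgroup_is_group)
  have "finite (carrier (G Mod N))" using fin by (simp add: carrier_FactGroup)
  then obtain d \<rho> where \<rho>: "is_rep (G Mod N) d \<rho>"
    "\<And>C. C \<in> carrier (G Mod N) \<Longrightarrow> \<rho> C = 1\<^sub>m d \<Longrightarrow> C = \<one>\<^bsub>G Mod N\<^esub>"
    by (rule Q.regular_rep) blast
  have "group_hom G (G Mod N) (\<lambda>a. N #> a)"
    by unfold_locales (rule N.r_coset_hom_Mod)
  then have rep: "is_rep G d (\<lambda>g. \<rho> (N #> g))" by (rule rep_comp_hom[OF \<rho>(1)])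
  have "\<rho> (N #> g) = 1\<^sub>m d \<longleftrightarrow> g \<in> N" if g: "g \<in> carrier G" for g
  proof
    assume "\<rho> (N #> g) = 1\<^sub>m d"
    then have "N #> g = N" using \<rho>(2)[of "N #> g"] g by (auto simp: carrier_FactGroup)
    then show "g \<in> N" using rcos_self[OF g N.subgroup_axioms] by simp
  next
    assume "g \<in> N"
    then show "\<rho> (N #> g) = 1\<^sub>m d"
      using coset_join2[OF g N.subgroup_axioms] is_repD(3)[OF \<rho>(1)] by simp
  qed
  then have "rep_kernel G d (\<lambda>g. \<rho> (N #> g)) = N"
    using N.subset by (auto simp: rep_kernel_def)
  then show thesis using rep by (rule that[rotated])
qed

text \<open>\<open>\<sigma>\<close> is the action on an invariant subspace and \<open>\<tau>\<close>
  the action on the quotient by it. An element trivial on both has a unipotent block matrix of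
  finite order, which is the identity.\<close>

lemma (in group) reducible_rep_split:
  assumes \<rho>: "is_rep G d \<rho>" and nirr: "\<not> irreducible_rep G d \<rho>" and fin: "finite (carrier G)"
  obtains k \<sigma> l \<tau> where "k < d" "is_rep G k \<sigma>" "l < d" "is_rep G l \<tau>"
    "rep_kernel G d \<rho> = rep_kernel G k \<sigma> \<inter> rep_kernel G l \<tau>"
proof -
  note r = is_repD[OF \<rho>]
  obtain W where W: "is_subspace d W" "W \<noteq> {0\<^sub>v d}" "W \<noteq> carrier_vec d"
    and inv: "\<And>g v. g \<in> carrier G \<Longrightarrow> v \<in> W \<Longrightarrow> \<rho> g *\<^sub>v v \<in> W"
    using nirr \<rho> unfolding irreducible_rep_def by blast
  obtain k l P Q where kl: "0 < k" "0 < l" "k + l = d" and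
    PQ: "P \<in> carrier_mat d d" "Q \<in> carrier_mat d d" "P * Q = 1\<^sub>m d" "Q * P = 1\<^sub>m d" and
    blk: "\<And>A. A \<in> carrier_mat d d \<Longrightarrow> (\<And>v. v \<in> W \<Longrightarrow> A *\<^sub>v v \<in> W) \<Longrightarrow>
      \<exists>B C D. B \<in> carrier_mat k k \<and> C \<in> carrier_mat k l \<and> D \<in> carrier_mat l l \<and>
        Q * A * P = four_block_mat B C (0\<^sub>m l k) D"
    by (rule block_decomposition[OF W]) blast
  have "\<forall>g \<in> carrier G. \<exists>B C D. B \<in> carrier_mat k k \<and> C \<in> carrier_mat k l \<and> D \<in> carrier_mat l l \<and>
        Q * \<rho> g * P = four_block_mat B C (0\<^sub>m l k) D"
    using blk[OF r(2)] inv by blast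
  \<comment> \<open>The blocks are chosen separately for each \<open>g\<close>; uniqueness of blocks
    then makes both diagonal choices multiplicative.\<close>
  then obtain \<sigma> C \<tau> where b: "\<And>g. g \<in> carrier G \<Longrightarrow> \<sigma> g \<in> carrier_mat k k"
    "\<And>g. g \<in> carrier G \<Longrightarrow> C g \<in> carrier_mat k l" "\<And>g. g \<in> carrier G \<Longrightarrow> \<tau> g \<in> carrier_mat l l"
    and T: "\<And>g. g \<in> carrier G \<Longrightarrow> Q * \<rho> g * P = four_block_mat (\<sigma> g) (C g) (0\<^sub>m l k) (\<tau> g)"
    by metis
  have triv: "\<sigma> g = 1\<^sub>m k \<and> \<tau> g = 1\<^sub>m l" if g: "g \<in> carrier G" "\<rho> g = 1\<^sub>m d" for g
  proof -
    have "four_block_mat (\<sigma> g) (C g) (0\<^sub>m l k) (\<tau> g) = four_block_mat (1\<^sub>m k) (0\<^sub>m k l) (0\<^sub>m l k) (1\<^sub>m l)"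
      using T[OF g(1)] g(2) PQ kl(3) by simp
    from four_block_mat_inject[OF this, of k l] show ?thesis using b[OF g(1)] by simp
  qed
  have mult: "\<sigma> (g \<otimes> h) = \<sigma> g * \<sigma> h \<and> \<tau> (g \<otimes> h) = \<tau> g * \<tau> h"
    if g: "g \<in> carrier G" and h: "h \<in> carrier G" for g h
  proof -
    have car: "\<rho> g \<in> carrier_mat d d" "\<rho> h \<in> carrier_mat d d" using g h by (auto intro: r)
    have "(Q * \<rho> g * P) * (Q * \<rho> h * P) = Q * \<rho> g * ((P * Q) * (\<rho> h * P))"
      using car PQ(1,2) by (simp add: assoc_mult_mat[of _ d d _ d _ d])
    also have "\<dots> = Q * (\<rho> g * \<rho> h) * P"
      using car PQ by (simp add: assoc_mult_mat[of _ d d _ d _ d])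
    finally have "Q * \<rho> (g \<otimes> h) * P = (Q * \<rho> g * P) * (Q * \<rho> h * P)" using r(4)[OF g h] by simp
    then have "four_block_mat (\<sigma> (g \<otimes> h)) (C (g \<otimes> h)) (0\<^sub>m l k) (\<tau> (g \<otimes> h)) =
        four_block_mat (\<sigma> g * \<sigma> h) (\<sigma> g * C h + C g * \<tau> h) (0\<^sub>m l k) (\<tau> g * \<tau> h)"
      unfolding T[OF g] T[OF h] T[OF m_closed[OF g h]]
        mult_four_block_mat[OF b(1,2)[OF g] zero_carrier_mat b(3)[OF g] b(1,2)[OF h] zero_carrier_mat b(3)[OF h]]
      using b[OF g] b[OF h] left_add_zero_mat[OF mult_carrier_mat[OF b(3)[OF g] b(3)[OF h]]]
        right_add_zero_mat[OF mult_carrier_mat[OF b(1)[OF g] b(1)[OF h]]] by simp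
    from four_block_mat_inject[OF this, of k l] show ?thesis
      using b[OF g] b[OF h] b[OF m_closed[OF g h]] by auto
  qed
  have reps: "is_rep G k \<sigma>" "is_rep G l \<tau>"
    unfolding is_rep_def using kl b triv[OF one_closed r(3)] mult by auto
  have m: "0 < Coset.order G" using fin order_gt_0_iff_finite by blast
  have "\<rho> g = 1\<^sub>m d" if g: "g \<in> carrier G" and s: "\<sigma> g = 1\<^sub>m k" "\<tau> g = 1\<^sub>m l" for g
  proof -
    have s': "\<sigma> g = 1 \<cdot>\<^sub>m 1\<^sub>m k" "\<tau> g = 1 \<cdot>\<^sub>m 1\<^sub>m l" using s by auto
    have "(Q * \<rho> g * P) ^\<^sub>m Coset.order G = 1\<^sub>m d"
      unfolding conjugate_pow[OF r(2)[OF g] PQ] rep_finite_order[OF \<rho> g] using PQ by simp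
    then have "Q * \<rho> g * P = 1 \<cdot>\<^sub>m 1\<^sub>m d"
      using finite_order_upper_block_scalar[OF b(2)[OF g] kl(1) m, of 1]
      unfolding T[OF g] s' kl(3) by blast
    then have "\<rho> g = 1 \<cdot>\<^sub>m 1\<^sub>m d" by (rule scalar_if_conjugate_scalar[OF r(2)[OF g] PQ(1-3)])
    moreover have "1 \<cdot>\<^sub>m 1\<^sub>m d = (1\<^sub>m d :: complex mat)" by (rule eq_matI) auto
    ultimately show ?thesis by simp
  qed
  then have "rep_kernel G d \<rho> = rep_kernel G k \<sigma> \<inter> rep_kernel G l \<tau>"
    using triv by (auto simp: rep_kernel_def)
  then show thesis using kl reps by (intro that) auto
qed

text \<open>Induction on the degree: the kernel is the intersection of two kernels of smaller
  degree, so \<open>x\<close> is missing from one of them, and that one contains the original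
  kernel.\<close>

lemma (in group) irreducible_rep_separates:
  assumes \<rho>: "is_rep G d \<rho>" and fin: "finite (carrier G)" and x: "x \<in> carrier G" "x \<notin> rep_kernel G d \<rho>"
  shows "\<exists>k \<sigma>. irreducible_rep G k \<sigma> \<and> rep_kernel G d \<rho> \<subseteq> rep_kernel G k \<sigma> \<and> x \<notin> rep_kernel G k \<sigma>"
  using \<rho> x(2)
proof (induction d arbitrary: \<rho> rule: less_induct)
  case (less d)
  show ?case
  proof (cases "irreducible_rep G d \<rho>")
    case True
    then show ?thesis using less.prems by blast
  next
    case False
    obtain k \<sigma> l \<tau> where kl: "k < d" "is_rep G k \<sigma>" "l < d" "is_rep G l \<tau>"
      "rep_kernel G d \<rho> = rep_kernel G k \<sigma> \<inter> rep_kernel G l \<tau>"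
      by (rule reducible_rep_split[OF less.prems(1) False fin])
    then consider "x \<notin> rep_kernel G k \<sigma>" | "x \<notin> rep_kernel G l \<tau>" using less.prems by blast
    then show ?thesis
    proof cases
      case 1
      from less.IH[OF kl(1,2) 1] kl(5) show ?thesis by blast
    next
      case 2
      from less.IH[OF kl(3,4) 2] kl(5) show ?thesis by blast
    qed
  qed
qed

section \<open>The trivial character, and \<open>Z_N\<close> as an intersection of centers\<close>

lemma trivial_rep_irreducible: "irreducible_rep G 1 (\<lambda>_. 1\<^sub>m 1)"
  unfolding irreducible_rep_def
proof (intro conjI allI impI)
  show "is_rep G 1 (\<lambda>_. 1\<^sub>m 1)" by (simp add: is_rep_def)
  fix W assume "is_subspace 1 W \<and> (\<forall>g\<in>carrier G. \<forall>v\<in>W. 1\<^sub>m 1 *\<^sub>v v \<in> W)"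
  then have W: "W \<subseteq> carrier_vec 1" "0\<^sub>v 1 \<in> W" "\<And>c v. v \<in> W \<Longrightarrow> c \<cdot>\<^sub>v v \<in> W"
    by (auto simp: is_subspace_def)
  show "W = {0\<^sub>v 1} \<or> W = carrier_vec 1"
  proof (cases "W = {0\<^sub>v 1}")
    case False
    then obtain v where v: "v \<in> W" "v \<noteq> 0\<^sub>v 1" using W(2) by blast
    then have vc: "v \<in> carrier_vec 1" using W(1) by blast
    have v0: "v $ 0 \<noteq> 0"
    proof
      assume "v $ 0 = 0"
      then have "v = 0\<^sub>v 1" using vc by (intro eq_vecI) auto
      then show False using v(2) by blast
    qed
    have "w \<in> W" if "w \<in> carrier_vec 1" for w
    proof -
      have "w = (w $ 0 / v $ 0) \<cdot>\<^sub>v v" using that vc v0 by (intro eq_vecI) auto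
      then show ?thesis using W(3)[OF v(1)] by metis
    qed
    then show ?thesis using W(1) by blast
  qed simp
qed

text \<open>The trivial character has center \<open>G\<close>. This provides the top term of the
  chain and makes the families of centers below nonempty.\<close>

lemma (in group) carrier_in_centers:
  assumes fin: "finite (carrier G)"
  shows "carrier G \<in> centers G"
proof -
  have rep: "is_rep G 1 (\<lambda>_. 1\<^sub>m 1)" using trivial_rep_irreducible[of G] by (simp add: irreducible_rep_def)
  have "1\<^sub>m 1 = 1 \<cdot>\<^sub>m (1\<^sub>m 1 :: complex mat)" by (rule eq_matI) auto
  then have "char_center G (character G (\<lambda>_. 1\<^sub>m 1)) = carrier G"
    unfolding char_center_eq_scalars[OF rep fin] by blast
  then show ?thesis using trivial_rep_irreducible[of G] unfolding centers_def Irr_def by (auto simp: image_iff)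
qed

lemma centersE:
  assumes "C \<in> centers G"
  obtains d \<rho> where "irreducible_rep G d \<rho>" "C = char_center G (character G \<rho>)"
  using assms unfolding centers_def Irr_def by blast

lemma (in group) centers_obtain_Zq:
  assumes fin: "finite (carrier G)" and "C \<in> centers G"
  obtains N where "N \<lhd> G" "C = Zq G N"
proof -
  from assms(2) obtain d \<rho> where \<rho>: "irreducible_rep G d \<rho>" "C = char_center G (character G \<rho>)"
    by (rule centersE)
  then have "rep_kernel G d \<rho> \<lhd> G" by (intro rep_kernel_normal) (simp add: irreducible_rep_def)
  then show thesis using that char_center_eq_Zq_kernel[OF \<rho>(1) fin] \<rho>(2) by blast
qed

text \<open>If \<open>g\<close> is outside \<open>Z_N\<close>, some commutator of \<open>g\<close>
  is outside \<open>N\<close>. An irreducible representation trivial on \<open>N\<close> but not on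
  that commutator has a center that contains \<open>Z_N\<close> and misses \<open>g\<close>. The
  family is indexed by containment of \<open>Z_N\<close>, so one inclusion is immediate.\<close>

lemma (in group) Zq_eq_Inter_centers:
  assumes N: "N \<lhd> G" and fin: "finite (carrier G)"
  shows "Zq G N = \<Inter>{C \<in> centers G. Zq G N \<subseteq> C}"
proof
  show "\<Inter>{C \<in> centers G. Zq G N \<subseteq> C} \<subseteq> Zq G N"
  proof
    fix g assume "g \<in> \<Inter>{C \<in> centers G. Zq G N \<subseteq> C}"
    then have gC: "g \<in> C" if "C \<in> centers G" "Zq G N \<subseteq> C" for C using that by blast
    have g: "g \<in> carrier G" using gC[OF carrier_in_centers[OF fin]] by (auto simp: Zq_def)
    show "g \<in> Zq G N"
    proof (rule ccontr)
      assume "g \<notin> Zq G N"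
      then obtain h where h: "h \<in> carrier G" "(g \<otimes> h) \<otimes> inv (h \<otimes> g) \<notin> N"
        using g unfolding Zq_iff_commutator[OF N] by blast
      obtain d \<rho> where \<rho>: "is_rep G d \<rho>" "rep_kernel G d \<rho> = N" by (rule rep_with_kernel[OF N fin])
      have "(g \<otimes> h) \<otimes> inv (h \<otimes> g) \<in> carrier G" using g h by simp
      then obtain k \<sigma> where \<sigma>: "irreducible_rep G k \<sigma>" "N \<subseteq> rep_kernel G k \<sigma>"
        "(g \<otimes> h) \<otimes> inv (h \<otimes> g) \<notin> rep_kernel G k \<sigma>"
        using irreducible_rep_separates[OF \<rho>(1) fin] h(2) unfolding \<rho>(2) by blast
      have ker: "rep_kernel G k \<sigma> \<lhd> G" using \<sigma>(1) by (intro rep_kernel_normal) (simp add: irreducible_rep_def)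
      have "Zq G (rep_kernel G k \<sigma>) \<in> centers G"
        unfolding char_center_eq_Zq_kernel[OF \<sigma>(1) fin, symmetric]
        using \<sigma>(1) by (auto simp: centers_def Irr_def)
      \<comment> \<open>Commutators lying in \<open>N\<close> lie in the larger kernel too.\<close>
      moreover have "Zq G N \<subseteq> Zq G (rep_kernel G k \<sigma>)"
        using \<sigma>(2) unfolding Zq_iff_commutator[OF N] Zq_iff_commutator[OF ker] by blast
      ultimately have "g \<in> Zq G (rep_kernel G k \<sigma>)" by (rule gC)
      then show False using \<sigma>(3) h(1) unfolding Zq_iff_commutator[OF ker] by blast
    qed
  qed
qed blast

subsection \<open>Nested groups\<close>

lemma nested_iff_centers:
  "nested G \<longleftrightarrow> (\<forall>C \<in> centers G. \<forall>D \<in> centers G. C \<subseteq> D \<or> D \<subseteq> C)"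
  unfolding nested_def centers_def by blast

lemma finite_centers:
  assumes "finite (carrier G)"
  shows "finite (centers G)"
proof -
  have "centers G \<subseteq> Pow (carrier G)" by (auto simp: centers_def char_center_def)
  then show ?thesis using assms finite_subset by blast
qed

text \<open>In a finite chain a minimal member is least, and so equals the intersection.\<close>

lemma finite_chain_Inter_mem:
  assumes "finite S" "S \<noteq> {}" "\<And>A B. A \<in> S \<Longrightarrow> B \<in> S \<Longrightarrow> A \<subseteq> B \<or> B \<subseteq> A"
  shows "\<Inter>S \<in> S"
proof -
  obtain M where M: "M \<in> S" "\<And>A. A \<in> S \<Longrightarrow> A \<subseteq> M \<Longrightarrow> M = A"
    using finite_has_minimal[OF assms(1,2)] by blast
  then have "M \<subseteq> A" if "A \<in> S" for A using assms(3)[OF M(1) that] that by blast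
  then have "\<Inter>S = M" using M(1) by blast
  then show ?thesis using M(1) by simp
qed

text \<open>The centers containing \<open>Z_N\<close> form a finite nonempty chain, so their
  intersection \<open>Z_N\<close> is one of them.\<close>

lemma (in group) nested_imp_Zq_in_centers:
  assumes "nested G" and N: "N \<lhd> G" and fin: "finite (carrier G)"
  shows "Zq G N \<in> centers G"
proof -
  have "\<Inter>{C \<in> centers G. Zq G N \<subseteq> C} \<in> {C \<in> centers G. Zq G N \<subseteq> C}"
  proof (rule finite_chain_Inter_mem)
    show "finite {C \<in> centers G. Zq G N \<subseteq> C}" using finite_centers[OF fin] by simp
    have "carrier G \<in> {C \<in> centers G. Zq G N \<subseteq> C}"
      using carrier_in_centers[OF fin] by (auto simp: Zq_def)
    then show "{C \<in> centers G. Zq G N \<subseteq> C} \<noteq> {}" by blast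
  qed (use assms(1) in \<open>auto simp: nested_iff_centers\<close>)
  then show ?thesis using Zq_eq_Inter_centers[OF N fin] by simp
qed

text \<open>In a nested group every \<open>Z_N\<close> is a center; in any finite group every center
  is \<open>Z_K\<close> for the kernel \<open>K\<close> of a representation.\<close>

lemma (in group) nested_iff_Zq_comparable:
  assumes fin: "finite (carrier G)"
  shows "nested G \<longleftrightarrow> (\<forall>N M. N \<lhd> G \<longrightarrow> M \<lhd> G \<longrightarrow> Zq G N \<subseteq> Zq G M \<or> Zq G M \<subseteq> Zq G N)"
proof
  assume "nested G"
  then show "\<forall>N M. N \<lhd> G \<longrightarrow> M \<lhd> G \<longrightarrow> Zq G N \<subseteq> Zq G M \<or> Zq G M \<subseteq> Zq G N"
    using nested_imp_Zq_in_centers[OF _ _ fin] unfolding nested_iff_centers by blast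
next
  assume *: "\<forall>N M. N \<lhd> G \<longrightarrow> M \<lhd> G \<longrightarrow> Zq G N \<subseteq> Zq G M \<or> Zq G M \<subseteq> Zq G N"
  show "nested G"
    unfolding nested_iff_centers using * centers_obtain_Zq[OF fin] by metis
qed

section \<open>Strictly decreasing chains and the chain of centers\<close>

lemma strict_chain_antimono:
  assumes "\<forall>i<n. X (Suc i) \<subset> (X i :: 'a set)" "i \<le> j" "j \<le> n"
  shows "X j \<subseteq> X i"
  using assms(2,3)
proof (induction j rule: dec_induct)
  case (step j)
  then show ?case using assms(1) by (metis Suc_le_eq Suc_leD order_trans psubset_imp_subset)
qed simp

text \<open>The least member is removed, the rest is enumerated by induction, and the least member
  is appended at the end.\<close>

lemma finite_chain_enumeration:
  assumes "finite S" "S \<noteq> {}" "\<And>A B. A \<in> S \<Longrightarrow> B \<in> S \<Longrightarrow> A \<subseteq> B \<or> B \<subseteq> A"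
  shows "\<exists>(n::nat) X. X ` {0..n} = S \<and> (\<forall>i<n. X (Suc i) \<subset> X i)"
  using assms
proof (induction "card S" arbitrary: S rule: less_induct)
  case less
  define M where "M = \<Inter>S"
  have M: "M \<in> S" unfolding M_def by (rule finite_chain_Inter_mem) (use less.prems in auto)
  show ?case
  proof (cases "S = {M}")
    case True
    then show ?thesis by (intro exI[of _ 0] exI[of _ "\<lambda>_. M"]) auto
  next
    case False
    have "card (S - {M}) < card S" using M less.prems(1) by (meson card_Diff1_less)
    then have "\<exists>(n::nat) X. X ` {0..n} = S - {M} \<and> (\<forall>i<n. X (Suc i) \<subset> X i)"
      by (rule less.hyps) (use less.prems M False in auto)
    then obtain n :: nat and X where X: "X ` {0..n} = S - {M}" "\<forall>i<n. X (Suc i) \<subset> X i"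
      by (elim exE conjE) (rule that)
    have "X n \<in> S - {M}" unfolding X(1)[symmetric] by simp
    then have "M \<subset> X n" by (auto simp: M_def)
    then have "\<forall>i<Suc n. (X(Suc n := M)) (Suc i) \<subset> (X(Suc n := M)) i"
      using X(2) by (auto simp: less_Suc_eq)
    moreover have "(X(Suc n := M)) ` {0..Suc n} = S"
    proof -
      have "{0..Suc n} = insert (Suc n) {0..n}" by auto
      moreover have "(X(Suc n := M)) ` {0..n} = X ` {0..n}" by (intro image_cong) auto
      ultimately show ?thesis using M by (simp only: image_insert fun_upd_same X(1) insert_Diff)
    qed
    ultimately show ?thesis by (intro exI[of _ "Suc n"] exI[of _ "X(Suc n := M)"] conjI)
  qed
qed

text \<open>The chain is the enumeration of the centers themselves, each normal, and every
  \<open>Z_N\<close> occurs among them.\<close>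

lemma (in group) nested_chain_exists:
  assumes "nested G" and fin: "finite (carrier G)"
  shows "\<exists>(n::nat) X. X 0 = carrier G \<and> (\<forall>i\<le>n. X i \<lhd> G) \<and>
    (\<forall>i<n. X (Suc i) \<subset> X i) \<and> (\<forall>N. N \<lhd> G \<longrightarrow> (\<exists>i\<le>n. Zq G N = X i))"
proof -
  have "\<exists>(n::nat) X. X ` {0..n} = centers G \<and> (\<forall>i<n. X (Suc i) \<subset> X i)"
    by (rule finite_chain_enumeration)
      (use finite_centers[OF fin] carrier_in_centers[OF fin] assms(1) in \<open>auto simp: nested_iff_centers\<close>)
  then obtain n :: nat and X where X: "X ` {0..n} = centers G" "\<forall>i<n. X (Suc i) \<subset> X i"
    by (elim exE conjE) (rule that)
  have Xc: "X i \<in> centers G" if "i \<le> n" for i using X(1) that by auto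
  have idx: "\<exists>i\<le>n. C = X i" if "C \<in> centers G" for C
  proof -
    have "C \<in> X ` {0..n}" unfolding X(1) by (rule that)
    then show ?thesis by (rule imageE) auto
  qed
  obtain j where j: "j \<le> n" "carrier G = X j" using idx[OF carrier_in_centers[OF fin]] by blast
  have "X 0 \<subseteq> carrier G" using Xc[of 0] by (auto simp: centers_def char_center_def)
  \<comment> \<open>\<open>G\<close> occurs at some index \<open>j\<close>, and the chain decreases
    from index 0, so \<open>X 0\<close> contains \<open>G\<close>.\<close>
  then have "X 0 = carrier G" using strict_chain_antimono[OF X(2), of 0 j] j by auto
  moreover have "X i \<lhd> G" if "i \<le> n" for i
    using Xc[OF that] char_center_normal[OF _ fin] by (metis centersE)
  moreover have "\<exists>i\<le>n. Zq G N = X i" if "N \<lhd> G" for N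
    using nested_imp_Zq_in_centers[OF assms(1) that fin] by (rule idx)
  ultimately show ?thesis using X(2) by (intro exI[of _ n] exI[of _ X]) simp
qed

lemma (in group) nested_if_chain:
  assumes fin: "finite (carrier G)" and X: "\<forall>i<n. X (Suc i) \<subset> X i"
    and Z: "\<And>N. N \<lhd> G \<Longrightarrow> \<exists>i\<le>n. Zq G N = X i"
  shows "nested G"
  unfolding nested_iff_Zq_comparable[OF fin]
proof (intro allI impI)
  fix N M assume "N \<lhd> G" "M \<lhd> G"
  then obtain i j where "i \<le> n" "Zq G N = X i" "j \<le> n" "Zq G M = X j" using Z by meson
  then show "Zq G N \<subseteq> Zq G M \<or> Zq G M \<subseteq> Zq G N"
    using strict_chain_antimono[OF X, of i j] strict_chain_antimono[OF X, of j i] by (metis linear)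
qed

text \<open>Each term is some \<open>Z_N\<close>, a center because \<open>G\<close> is nested; each
  center is some \<open>Z_N\<close>, hence a term.\<close>

lemma (in group) chain_eq_centers:
  fixes n :: nat
  assumes fin: "finite (carrier G)" and "nested G"
    and Z: "\<And>N. N \<lhd> G \<Longrightarrow> \<exists>i\<le>n. Zq G N = X i" and X: "\<And>i. i \<le> n \<Longrightarrow> \<exists>N. N \<lhd> G \<and> Zq G N = X i"
  shows "X ` {0..n} = centers G"
proof
  show "X ` {0..n} \<subseteq> centers G"
  proof
    fix C assume "C \<in> X ` {0..n}"
    then obtain i where "i \<le> n" "C = X i" by auto
    then obtain N where "N \<lhd> G" "Zq G N = C" using X by blast
    then show "C \<in> centers G" using nested_imp_Zq_in_centers[OF assms(2) _ fin] by blast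
  qed
  show "centers G \<subseteq> X ` {0..n}"
  proof
    fix C assume "C \<in> centers G"
    then obtain N where "N \<lhd> G" "C = Zq G N" by (rule centers_obtain_Zq[OF fin])
    then obtain i where "i \<le> n" "C = X i" using Z by metis
    then show "C \<in> X ` {0..n}" by (intro image_eqI[of _ X i]) auto
  qed
qed

theorem theorem1p3:
  fixes G :: "('a, 'b) monoid_scheme"
  assumes "group G" and "finite (carrier G)"
  shows "(nested G \<longleftrightarrow>
            (\<exists>(n::nat) X. X 0 = carrier G \<and> (\<forall>i\<le>n. X i \<lhd> G) \<and>
               (\<forall>i<n. X (Suc i) \<subset> X i) \<and>
               (\<forall>N. N \<lhd> G \<longrightarrow> (\<exists>i\<le>n. Zq G N = X i))))
       \<and> (nested G \<longleftrightarrow>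
            (\<forall>N M. N \<lhd> G \<longrightarrow> M \<lhd> G \<longrightarrow> Zq G N \<subseteq> Zq G M \<or> Zq G M \<subseteq> Zq G N))
       \<and> (\<forall>(n::nat) X. X 0 = carrier G \<and> (\<forall>i\<le>n. X i \<lhd> G) \<and>
               (\<forall>i<n. X (Suc i) \<subset> X i) \<and>
               (\<forall>N. N \<lhd> G \<longrightarrow> (\<exists>i\<le>n. Zq G N = X i)) \<and>
               (\<forall>i\<le>n. \<exists>N. N \<lhd> G \<and> Zq G N = X i)
            \<longrightarrow> nested G \<and> X ` {0..n} = centers G)"
proof -
  interpret group G by fact
  note fin = assms(2)
  show ?thesis (is "(_ \<longleftrightarrow> ?chain) \<and> _ \<and> _")
  proof (intro conjI allI impI)
    show "nested G \<longleftrightarrow> ?chain"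
    proof
      show ?chain if "nested G" by (rule nested_chain_exists[OF that fin])
      show "nested G" if ?chain
        using that by (elim exE conjE) (rule nested_if_chain[OF fin], assumption, simp)
    qed
    show "nested G \<longleftrightarrow>
            (\<forall>N M. N \<lhd> G \<longrightarrow> M \<lhd> G \<longrightarrow> Zq G N \<subseteq> Zq G M \<or> Zq G M \<subseteq> Zq G N)"
      by (rule nested_iff_Zq_comparable[OF fin])
  next
    fix n :: nat and X
    assume *: "X 0 = carrier G \<and> (\<forall>i\<le>n. X i \<lhd> G) \<and>
               (\<forall>i<n. X (Suc i) \<subset> X i) \<and>
               (\<forall>N. N \<lhd> G \<longrightarrow> (\<exists>i\<le>n. Zq G N = X i)) \<and>
               (\<forall>i\<le>n. \<exists>N. N \<lhd> G \<and> Zq G N = X i)"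
    \<comment> \<open>Nestedness comes first because identifying the terms with centers relies on
      it.\<close>
    then show "nested G" by (elim conjE) (rule nested_if_chain[OF fin], assumption, simp)
    then show "X ` {0..n} = centers G" by (rule chain_eq_centers[OF fin]) (use * in simp_all)
  qed
qed

end
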